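(* Let $s\ge1$ and $q=2^s$. Up to isotopy, the presemifields $B(2,2s,s,l,t)$ with $l\neq 0$ coincide with the semifields $B_q(w)$. That is, every $B(2,2s,s,l,t)$ with $t$ legitimate and $l\in L^*\setminus(L^* )^{q-1}$ is isotopic to $B_q(w)$ for some $w\in L\setminus K$ with $\mathrm{tr}_{K|\mathbb{F}_2}(1/\tau(w))=0$, and conversely every such $B_q(w)$ is isotopic to some such $B(2,2s,s,l,t)$.
   Context: A (finite) presemifield is a finite additive abelian group with a multiplication that is distributive on both sides over addition and has no zero divisors; it is a semifield if it also has a multiplicative identity. Two presemifields $(F,+,* )$ and $(F,+,\circ)$ are isotopic if there are additive bijections $\alpha_1,\alpha_2,\beta$ with $\beta(\alpha_1(x)*\alpha_2(y))=x\circ y$ for all $x,y$. Let $q=2^s$, $K=\mathbb{F}_q\subset L=\mathbb{F}_{q^2}$, $\tau:L\to K$, $\tau(u)=u+u^q$, the trace, and $\mathrm{tr}_{K|\mathbb{F}_2}$ the absolute trace of $K$; $(L^* )^{q-1}=\{u^{q-1}:u\in L^*\}$. A quadruple $t=[p_1,p_2,p_3,p_4]\in L^4$ is legitimate (for $m=2s$, $\sigma=2^s=q$) if $p_1\neq0$ and $p_1X^{q+1}+p_2X^{q}+p_3X+p_4$ has no root in $L$. $B(2,2s,s,l,t)$ is the presemifield on $L\times L$ with multiplication $$(a,b)\circ(c,d)=(p_1ac^{q}+lp_1a^{q}c+p_2bc^{q}+lp_2a^{q}d+p_3ad^{q}+lp_3b^{q}c+p_4bd^{q}+lp_4b^{q}d,\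 ad+bc).$$ For $w\in L\setminus K$ with $\mathrm{tr}_{K|\mathbb{F}_2}(1/\tau(w))=0$, $B_q(w)$ is the semifield on $L\times L$ with multiplication $$(a,b)\star(c,d)=(ac+bd^q+wb^qd,\ a^qd+bc).$$ *)

theory Defs
  imports
    "HOL-Computational_Algebra.Computational_Algebra"
    "HOL-Number_Theory.Number_Theory"
    "HOL-Library.Cardinality"
    "HOL-Library.Product_Plus"
begin

section \<open>Presemifields, semifields and isotopy\<close>

text \<open>
  The additive group is the one of the type; only the multiplication is a parameter.
\<close>

definition presemifield :: "('b::{finite,ab_group_add} \<Rightarrow> 'b \<Rightarrow> 'b) \<Rightarrow> bool" where
  "presemifield mul \<longleftrightarrow>
     (\<forall>x y z. mul (x + y) z = mul x z + mul y z) \<and>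
     (\<forall>x y z. mul x (y + z) = mul x y + mul x z) \<and>
     (\<forall>x y. mul x y = 0 \<longrightarrow> x = 0 \<or> y = 0)"

definition semifield :: "('b::{finite,ab_group_add} \<Rightarrow> 'b \<Rightarrow> 'b) \<Rightarrow> bool" where
  "semifield mul \<longleftrightarrow> presemifield mul \<and> (\<exists>e. \<forall>x. mul e x = x \<and> mul x e = x)"

definition isotopic ::
  "('b::{finite,ab_group_add} \<Rightarrow> 'b \<Rightarrow> 'b) \<Rightarrow> ('b \<Rightarrow> 'b \<Rightarrow> 'b) \<Rightarrow> bool" where
  "isotopic mul1 mul2 \<longleftrightarrow>
     presemifield mul1 \<and> presemifield mul2 \<and>
     (\<exists>\<alpha>1 \<alpha>2 \<beta>.
        additive \<alpha>1 \<and> bij \<alpha>1 \<and> additive \<alpha>2 \<and> bij \<alpha>2 \<and> additive \<beta> \<and> bij \<beta> \<and>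
        (\<forall>x y. \<beta> (mul1 (\<alpha>1 x) (\<alpha>2 y)) = mul2 x y))"

section \<open>The fields $K \subset L$\<close>

text \<open>
  $L$ is a type \<open>'a\<close> with $q^2$ elements, where $q = 2^s$, and $K$ is its subfield of order $q$,
  i.e. the fixed field of $x \mapsto x^q$.
\<close>

definition subK :: "nat \<Rightarrow> 'a::finite_field set" where
  "subK s = {x. x ^ (2 ^ s) = x}"

definition rel_trace :: "nat \<Rightarrow> 'a::finite_field \<Rightarrow> 'a" where
  "rel_trace s u = u + u ^ (2 ^ s)"

text \<open>The absolute trace from $K$ to the prime field, as the sum of the $s$ conjugates;
  it is meaningful on \<open>subK s\<close> only.\<close>

definition abs_trace :: "nat \<Rightarrow> 'a::finite_field \<Rightarrow> 'a" where
  "abs_trace s x = (\<Sum>i<s. x ^ (2 ^ i))"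

definition powers_q_minus_1 :: "nat \<Rightarrow> 'a::finite_field set" where
  "powers_q_minus_1 s = {u ^ (2 ^ s - 1) | u. u \<noteq> 0}"

section \<open>The two families\<close>

definition legitimate :: "nat \<Rightarrow> 'a::finite_field \<times> 'a \<times> 'a \<times> 'a \<Rightarrow> bool" where
  "legitimate s = (\<lambda>(p1, p2, p3, p4).
     p1 \<noteq> 0 \<and> (\<forall>x. p1 * x ^ (2 ^ s + 1) + p2 * x ^ (2 ^ s) + p3 * x + p4 \<noteq> 0))"

text \<open>Multiplication of $B(2,2s,s,l,t)$.\<close>

definition B_mult ::
  "nat \<Rightarrow> 'a::finite_field \<Rightarrow> 'a \<times> 'a \<times> 'a \<times> 'a \<Rightarrow> 'a \<times> 'a \<Rightarrow> 'a \<times> 'a \<Rightarrow> 'a \<times> 'a" where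
  "B_mult s l = (\<lambda>(p1, p2, p3, p4) (a, b) (c, d). let q = 2 ^ s in
     (p1 * a * c ^ q + l * p1 * a ^ q * c + p2 * b * c ^ q + l * p2 * a ^ q * d
        + p3 * a * d ^ q + l * p3 * b ^ q * c + p4 * b * d ^ q + l * p4 * b ^ q * d,
      a * d + b * c))"

text \<open>Multiplication of $B_q(w)$, $q = 2^s$.\<close>

definition Bq_mult ::
  "nat \<Rightarrow> 'a::finite_field \<Rightarrow> 'a \<times> 'a \<Rightarrow> 'a \<times> 'a \<Rightarrow> 'a \<times> 'a" where
  "Bq_mult s w = (\<lambda>(a, b) (c, d). let q = 2 ^ s in
     (a * c + b * d ^ q + w * b ^ q * d, a ^ q * d + b * c))"

section \<open>Members of the first family are presemifields, those of the second semifields\<close>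

lemma CHAR_eq_2:
  assumes "CARD('a::finite_field) = (2 ^ s) ^ 2"
  shows "CHAR('a) = 2"
proof -
  have p: "prime CHAR('a)"
    by (simp add: prime_CHAR_semidom CHAR_pos)
  have "CHAR('a) dvd 2 ^ (s * 2)"
    using CHAR_dvd_CARD[where ?'a = 'a] assms by (simp add: power_mult)
  then show ?thesis
    using p prime_dvd_power primes_dvd_imp_eq two_is_prime_nat by blast
qed

lemma add_power_q:
  assumes "CARD('a::finite_field) = (2 ^ s) ^ 2"
  shows "(x + y :: 'a) ^ (2 ^ n) = x ^ (2 ^ n) + y ^ (2 ^ n)"
  using freshmans_dream'[where ?'a = 'a and m = "2 ^ n" and n = n and x = x and y = y]
  by (simp add: CHAR_eq_2[OF assms])

lemma add_self_eq_0:
  assumes "CARD('a::finite_field) = (2 ^ s) ^ 2"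
  shows "(x + x :: 'a) = 0"
proof -
  have "(2 :: 'a) = 0"
    using of_nat_CHAR[where ?'a = 'a] by (simp add: CHAR_eq_2[OF assms])
  then show ?thesis
    by (metis mult_2 mult_zero_left)
qed

lemma add_eq_0_iff_eq:
  assumes "CARD('a::finite_field) = (2 ^ s) ^ 2"
  shows "(x + y :: 'a) = 0 \<longleftrightarrow> x = y"
  using add_self_eq_0[OF assms] by (metis add_right_imp_eq)

lemma power_q_q:
  assumes "CARD('a::finite_field) = (2 ^ s) ^ 2"
  shows "((x :: 'a) ^ (2 ^ s)) ^ (2 ^ s) = x"
  using finite_field_power_card_eq_same[of x]
  by (simp add: assms power2_eq_square flip: power_mult)

lemma presemifield_B_mult:
  fixes l :: "'a::finite_field"
  assumes card: "CARD('a) = (2 ^ s) ^ 2"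
    and leg: "legitimate s t" and l: "l \<notin> powers_q_minus_1 s" "l \<noteq> 0"
  shows "presemifield (B_mult s l t)"
proof -
  obtain p1 p2 p3 p4 where t: "t = (p1, p2, p3, p4)"
    by (cases t)
  define q where "q = (2::nat) ^ s"
  have q: "q > 0" by (simp add: q_def)
  note [simp] = add_power_q[OF card, of _ _ s, folded q_def]
  define f where "f c d = p1 * c ^ (q + 1) + p2 * d * c ^ q + p3 * c * d ^ q + p4 * d ^ (q + 1)"
    for c d
  have p1: "p1 \<noteq> 0"
    and root: "p1 * x ^ (q + 1) + p2 * x ^ q + p3 * x + p4 \<noteq> 0" for x
    using leg by (auto simp: legitimate_def t q_def)
  have f0: "c = 0 \<and> d = 0" if "f c d = 0" for c d
  proof (cases "d = 0")
    case True
    then show ?thesis using that p1 q by (auto simp: f_def power_0_left)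
  next
    case False
    have "f c d = d ^ (q + 1) * (p1 * (c/d) ^ (q + 1) + p2 * (c/d) ^ q + p3 * (c/d) + p4)"
      using False by (simp add: f_def power_divide field_simps)
    then show ?thesis using that False root[of "c/d"] by auto
  qed
  have B: "B_mult s l t (a, b) (c, d) =
      (p1 * a * c ^ q + l * p1 * a ^ q * c + p2 * b * c ^ q + l * p2 * a ^ q * d
        + p3 * a * d ^ q + l * p3 * b ^ q * c + p4 * b * d ^ q + l * p4 * b ^ q * d,
      a * d + b * c)" for a b c d
    by (simp add: B_mult_def t q_def Let_def)
  have zero: "(a, b) = 0 \<or> (c, d) = 0" if m: "B_mult s l t (a, b) (c, d) = 0" for a b c d
  proof (rule ccontr)
    assume n: "\<not> ?thesis"
    have ad: "a * d = b * c"
      using m add_eq_0_iff_eq[OF card] by (simp add: B prod_eq_iff)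
    have cd: "c \<noteq> 0 \<or> d \<noteq> 0" and ab: "a \<noteq> 0 \<or> b \<noteq> 0"
      using n by (auto simp: zero_prod_def)
    define r where "r = (if c = 0 then b / d else a / c)"
    have r: "a = r * c" "b = r * d"
      using ad cd by (auto simp: r_def field_simps)
    have r0: "r \<noteq> 0" using r ab by auto
    have "(r + l * r ^ q) * f c d = 0"
      using m by (simp add: B prod_eq_iff r f_def power_mult_distrib algebra_simps)
    moreover have "f c d \<noteq> 0" using f0 cd by blast
    ultimately have "r + l * r ^ q = 0" by (metis mult_eq_0_iff)
    then have "l * r ^ q = r" using add_eq_0_iff_eq[OF card] by metis
    moreover have "r ^ q = r * r ^ (q - 1)"
      using q by (metis power_eq_if neq0_conv)
    ultimately have "r * (l * r ^ (q - 1)) = r * 1"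
      by (metis mult.left_commute mult_1_right)
    then have "l * r ^ (q - 1) = 1" using r0 by (simp only: mult_cancel_left) simp
    then have "l = (1 / r) ^ (q - 1)"
      using r0 by (simp add: field_simps)
    moreover have "1 / r \<noteq> 0" using r0 by simp
    ultimately show False using l unfolding powers_q_minus_1_def q_def by blast
  qed
  show ?thesis
    unfolding presemifield_def
  proof (intro conjI allI)
    fix x y z :: "'a \<times> 'a"
    show "B_mult s l t (x + y) z = B_mult s l t x z + B_mult s l t y z"
      by (cases x, cases y, cases z) (simp add: B algebra_simps)
    show "B_mult s l t x (y + z) = B_mult s l t x y + B_mult s l t x z"
      by (cases x, cases y, cases z) (simp add: B algebra_simps)
  next
    fix x y :: "'a \<times> 'a"
    show "B_mult s l t x y = 0 \<longrightarrow> x = 0 \<or> y = 0"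
      using zero by (cases x, cases y) blast
  qed
qed

lemma abs_trace_telescope:
  assumes "CARD('a::finite_field) = (2 ^ s) ^ 2"
  shows "abs_trace n (z ^ 2 + z :: 'a) = z ^ (2 ^ n) + z"
proof (induction n)
  case 0
  show ?case by (simp add: abs_trace_def add_self_eq_0[OF assms])
next
  case (Suc n)
  have "abs_trace (Suc n) (z ^ 2 + z) = abs_trace n (z ^ 2 + z) + (z ^ 2 + z) ^ (2 ^ n)"
    by (simp add: abs_trace_def)
  also have "\<dots> = z ^ (2 ^ Suc n) + z + (z ^ (2 ^ n) + z ^ (2 ^ n))"
  proof -
    have "(z ^ 2 + z) ^ (2 ^ n) = z ^ (2 ^ Suc n) + z ^ (2 ^ n)"
      by (simp add: add_power_q[OF assms] power_mult)
    then show ?thesis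
      by (simp only: Suc.IH) (simp only: ac_simps)
  qed
  finally show ?case by (simp add: add_self_eq_0[OF assms])
qed

lemma abs_trace_square:
  assumes "CARD('a::finite_field) = (2 ^ s) ^ 2"
  shows "abs_trace n ((x :: 'a) ^ 2) = (abs_trace n x) ^ 2"
proof (induction n)
  case 0
  show ?case by (simp add: abs_trace_def)
next
  case (Suc n)
  have "abs_trace (Suc n) x = abs_trace n x + x ^ (2 ^ n)"
    "abs_trace (Suc n) (x ^ 2) = abs_trace n (x ^ 2) + (x ^ 2) ^ (2 ^ n)"
    by (simp_all add: abs_trace_def)
  then show ?case
    using Suc.IH add_power_q[OF assms, of "abs_trace n x" "x ^ (2 ^ n)" 1]
    by (simp add: mult.commute flip: power_mult)
qed

lemma semifield_Bq_mult:
  fixes w :: "'a::finite_field"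
  assumes card: "CARD('a) = (2 ^ s) ^ 2"
    and w: "w \<notin> subK s" and tr: "abs_trace s (1 / rel_trace s w) = 0"
  shows "semifield (Bq_mult s w)"
proof -
  define q where "q = (2::nat) ^ s"
  have q: "q > 0" by (simp add: q_def)
  note add_q [simp] = add_power_q[OF card, of _ _ s, folded q_def]
  note qq [simp] = power_q_q[OF card, folded q_def]
  note eq0 = add_eq_0_iff_eq[OF card]
  define T where "T = w + w ^ q"
  have T0: "T \<noteq> 0"
    using w eq0[of w "w ^ q"] by (auto simp: T_def subK_def q_def)
  have Tq: "T ^ q = T" by (simp add: T_def add.commute)
  have norm: "(w + k) * (w + k) ^ q \<noteq> 1" if k: "k ^ q = k" for k
  proof
    assume N: "(w + k) * (w + k) ^ q = 1"
    define z where "z = (w + k) / T"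
    have kk: "k + k = 0" using add_self_eq_0[OF card] .
    have wk: "(w + k) ^ q = (w + k) + T"
      using add_self_eq_0[OF card, of w] by (simp add: T_def k algebra_simps)
    have "z ^ 2 + z = ((w + k) * ((w + k) + T)) / T ^ 2"
      using T0 by (simp add: z_def power2_eq_square field_simps)
    also have "\<dots> = (1 / T) ^ 2" using N wk by (simp add: power_divide)
    finally have "abs_trace s ((1 / T) ^ 2) = z ^ q + z"
      using abs_trace_telescope[OF card, of s z] by (simp add: q_def)
    moreover have "z ^ q + z = 1"
    proof -
      have "z ^ q = ((w + k) + T) / T"
        by (simp only: z_def power_divide Tq wk)
      then have "z ^ q + z = ((w + k) + T + (w + k)) / T"
        by (simp only: z_def add_divide_distrib)
      also have "(w + k) + T + (w + k) = T"
        using add_self_eq_0[OF card, of "w + k"] by (metis add.assoc add.commute add_0)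
      finally show ?thesis using T0 by simp
    qed
    moreover have "abs_trace s ((1 / T) ^ 2) = 0"
      using tr by (simp only: abs_trace_square[OF card]) (simp add: T_def rel_trace_def q_def)
    ultimately show False by simp
  qed
  have B: "Bq_mult s w (a, b) (c, d) = (a * c + b * d ^ q + w * b ^ q * d, a ^ q * d + b * c)"
    for a b c d
    by (simp add: Bq_mult_def q_def Let_def)
  have zero: "(a, b) = 0 \<or> (c, d) = 0" if m: "Bq_mult s w (a, b) (c, d) = 0" for a b c d
  proof -
    have m1: "a * c + b * d ^ q + w * b ^ q * d = 0" and "a ^ q * d + b * c = 0"
      using m by (simp_all add: B prod_eq_iff)
    then have m2: "a ^ q * d = b * c" using eq0 by blast
    consider "d = 0" | "d \<noteq> 0" "b = 0" | "d \<noteq> 0" "b \<noteq> 0" by blast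
    then show ?thesis
    proof cases
      case 1
      then show ?thesis using m1 m2 q by (auto simp: zero_prod_def power_0_left)
    next
      case 2
      then show ?thesis using m2 q by (auto simp: zero_prod_def)
    next
      case 3
      define k where "k = c ^ q * c / (d ^ q * d)"
      define v where "v = b * d ^ q / (b ^ q * d)"
      have k: "k ^ q = k" by (simp add: k_def power_divide power_mult_distrib mult.commute)
      have v: "v * v ^ q = 1"
        using 3 by (simp add: v_def power_divide power_mult_distrib field_simps)
      have "a ^ q = b * c / d" using m2 3 by (simp add: field_simps)
      then have "(a ^ q) ^ q = (b * c / d) ^ q" by simp
      then have a: "a = b ^ q * c ^ q / d ^ q"
        by (simp add: power_divide power_mult_distrib)
      have "(w + k) + v = (a * c + b * d ^ q + w * b ^ q * d) / (b ^ q * d)"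
        using 3 by (simp add: a k_def v_def field_simps)
      then have "w + k = v" using m1 eq0 by simp
      then show ?thesis using norm[OF k] v by simp
    qed
  qed
  have one: "Bq_mult s w (1, 0) x = x \<and> Bq_mult s w x (1, 0) = x" for x
    using q by (cases x) (simp add: B power_0_left)
  show ?thesis
    unfolding semifield_def presemifield_def
  proof (intro conjI allI exI[of _ "(1, 0)"])
    fix x y z :: "'a \<times> 'a"
    show "Bq_mult s w (x + y) z = Bq_mult s w x z + Bq_mult s w y z"
      by (cases x, cases y, cases z) (simp add: B algebra_simps)
    show "Bq_mult s w x (y + z) = Bq_mult s w x y + Bq_mult s w x z"
      by (cases x, cases y, cases z) (simp add: B algebra_simps)
    show "Bq_mult s w x y = 0 \<longrightarrow> x = 0 \<or> y = 0"
      using zero by (cases x, cases y) blast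
  qed (use one in auto)
qed

end

(* Write x' for x^q.  The multiplication of B(2,2s,s,l,t) is (P(x,y) + l P(y,x), x /\ y), where P is a
   sesquilinear form on L^2 and /\ is the determinant; legitimacy of t says that P is anisotropic.
   An anisotropic P can be diagonalised: after normalisation, an orthogonal basis is given by h + k
   and h + k', where k is a root of X^2 + (h + h' + 1) X + h h'.  This quadratic over K has a root in
   L by Artin-Schreier theory, and anisotropy says exactly that it has none in K.  For P = diag(a, d),
   an additive map z |-> l' a' z + a z' kills the coefficient that is absent in B_q(w), and scaling
   normalises the others.  With r = a' d and l l' = n^2, n in K, this gives
   w = (n^2 r + r') / (n (r + r')) of trace n + 1/n, whose inverse is y^2 + y for y = 1/(n + 1);
   conversely every w of the required kind arises in this way with l = n, a = 1. *)

theory Submission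
  imports Defs
begin

subsection \<open>Isotopy\<close>

text \<open>Bijectivity of the three maps is automatic: the kernels of \<open>\<alpha>1\<close> and \<open>\<alpha>2\<close> would
  produce zero divisors of \<open>mul2\<close>, and the range of \<open>\<beta>\<close> contains every product of \<open>mul2\<close>.\<close>

lemma isotopicI:
  fixes mul1 mul2 :: "'b::{finite,ab_group_add} \<Rightarrow> 'b \<Rightarrow> 'b"
  assumes pre: "presemifield mul1" "presemifield mul2"
    and add: "additive \<alpha>1" "additive \<alpha>2" "additive \<beta>"
    and eq: "\<And>x y. \<beta> (mul1 (\<alpha>1 x) (\<alpha>2 y)) = mul2 x y"
  shows "isotopic mul1 mul2"
proof (cases "\<exists>e::'b. e \<noteq> 0")
  \<comment> \<open>A nonzero element is what tests for zero divisors; in the trivial group, treated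
    second, every map is bijective.\<close>
  case True
  then obtain e :: 'b where e: "e \<noteq> 0" by blast
  have zero: "mul x 0 = 0" "mul 0 x = 0" if "presemifield mul"
    for x and mul :: "'b \<Rightarrow> 'b \<Rightarrow> 'b"
    using that unfolding presemifield_def by (metis add_0 add_cancel_left_left)+
  have nz: "x = 0 \<or> y = 0" if "mul2 x y = 0" for x y
    using that pre(2) unfolding presemifield_def by blast
  have \<beta>0: "\<beta> 0 = 0" using add(3) by (rule additive.zero)
  have inj: "inj f" if "additive f" "\<And>x. f x = 0 \<Longrightarrow> x = 0" for f :: "'b \<Rightarrow> 'b"
    using that additive.diff[OF that(1)] by (metis injI eq_iff_diff_eq_0)
  have "inj \<alpha>1"
    by (rule inj[OF add(1)]) (metis eq zero(2)[OF pre(1)] \<beta>0 nz e)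
  moreover have "inj \<alpha>2"
    by (rule inj[OF add(2)]) (metis eq zero(1)[OF pre(1)] \<beta>0 nz e)
  moreover have "surj \<beta>"
  proof -
    have "additive (mul2 e)"
      using pre(2) by (simp add: presemifield_def additive_def)
    then have "inj (mul2 e)" by (rule inj) (use nz e in blast)
    then have "surj (mul2 e)" by (simp add: finite_UNIV_inj_surj)
    then show ?thesis by (metis eq surj_def)
  qed
  ultimately have "bij \<alpha>1" "bij \<alpha>2" "bij \<beta>"
    by (auto simp: bij_def finite_UNIV_inj_surj finite_UNIV_surj_inj)
  with pre add eq show ?thesis unfolding isotopic_def by blast
next
  case False
  then have "x = y" for x y :: 'b by metis
  then have "bij f" for f :: "'b \<Rightarrow> 'b" by (metis (full_types) bijI')
  with pre add eq show ?thesis unfolding isotopic_def by blast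
qed

lemma isotopic_trans:
  assumes "isotopic mul1 mul2" "isotopic mul2 mul3"
  shows "isotopic mul1 mul3"
proof -
  obtain \<alpha>1 \<alpha>2 \<beta> where 1: "additive \<alpha>1" "additive \<alpha>2" "additive \<beta>"
    "\<And>x y. \<beta> (mul1 (\<alpha>1 x) (\<alpha>2 y)) = mul2 x y"
    using assms(1) unfolding isotopic_def by blast
  obtain \<gamma>1 \<gamma>2 \<delta> where 2: "additive \<gamma>1" "additive \<gamma>2" "additive \<delta>"
    "\<And>x y. \<delta> (mul2 (\<gamma>1 x) (\<gamma>2 y)) = mul3 x y"
    using assms(2) unfolding isotopic_def by blast
  show ?thesis
  proof (rule isotopicI)
    show "additive (\<alpha>1 \<circ> \<gamma>1)" "additive (\<alpha>2 \<circ> \<gamma>2)" "additive (\<delta> \<circ> \<beta>)"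
      using 1(1-3) 2(1-3) by (simp_all add: additive_def)
    show "(\<delta> \<circ> \<beta>) (mul1 ((\<alpha>1 \<circ> \<gamma>1) x) ((\<alpha>2 \<circ> \<gamma>2) y)) = mul3 x y" for x y
      by (simp add: 1(4) 2(4))
  qed (use assms in \<open>auto simp: isotopic_def\<close>)
qed

lemma isotopic_sym:
  assumes "isotopic mul1 mul2"
  shows "isotopic mul2 mul1"
proof -
  obtain \<alpha>1 \<alpha>2 \<beta> where add: "additive \<alpha>1" "additive \<alpha>2" "additive \<beta>"
    and bij: "bij \<alpha>1" "bij \<alpha>2" "bij \<beta>"
    and eq: "\<And>x y. \<beta> (mul1 (\<alpha>1 x) (\<alpha>2 y)) = mul2 x y"
    using assms unfolding isotopic_def by blast
  have inv: "additive (inv_into UNIV f)" if "additive f" "bij f" for f :: "'a \<Rightarrow> 'a"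
    using that unfolding additive_def
    by (metis bij_inv_eq_iff)
  show ?thesis
  proof (rule isotopicI)
    show "inv_into UNIV \<beta> (mul2 (inv_into UNIV \<alpha>1 x) (inv_into UNIV \<alpha>2 y)) = mul1 x y" for x y
      using bij by (metis eq bij_inv_eq_iff)
  qed (use assms add bij inv in \<open>auto simp: isotopic_def\<close>)
qed

subsection \<open>Trace, norm and quadratic equations\<close>

lemma card_le_mult_card_image:
  assumes "finite A" "\<And>b. b \<in> f ` A \<Longrightarrow> card {x \<in> A. f x = b} \<le> m"
  shows "card A \<le> m * card (f ` A)"
proof -
  have "A = (\<Union>b\<in>f ` A. {x \<in> A. f x = b})" by auto
  then have "card A \<le> (\<Sum>b\<in>f ` A. card {x \<in> A. f x = b})"
    using card_UN_le[of "f ` A" "\<lambda>b. {x \<in> A. f x = b}"] assms(1) by simp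
  also have "\<dots> \<le> (\<Sum>b\<in>f ` A. m)" using assms(2) by (rule sum_mono)
  finally show ?thesis by (simp add: mult.commute)
qed

text \<open>Fibres of size at most \<open>m\<close> force at least \<open>card A / m\<close> values,
  which already fills \<open>B\<close>. Trace, norm, Hilbert 90 and Artin-Schreier all rest on this
  count.\<close>

lemma image_eq_by_fibre_count:
  fixes f :: "'a \<Rightarrow> 'b"
  assumes "finite A" "finite B" "f ` A \<subseteq> B"
    and "\<And>b. card {x \<in> A. f x = b} \<le> m" "m * card B \<le> card A" "m > 0"
  shows "f ` A = B"
proof -
  have "m * card B \<le> m * card (f ` A)"
    using card_le_mult_card_image[OF assms(1,4)] assms(5) by (rule le_trans[rotated])
  then have "card B \<le> card (f ` A)" using assms(6) by simp
  then show ?thesis using assms(2,3) by (intro card_seteq)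
qed

text \<open>One shape of monic polynomial bounds all fibres that occur: \<open>a = 1\<close> for the
  trace and for \<open>z^2 + z\<close>, \<open>a = 0\<close> for the norm, and \<open>a = b\<close>
  for the equation \<open>cj u = b * u\<close>.\<close>

lemma card_power_plus_linear_le:
  fixes c :: "'a::finite_field"
  assumes "n > 1"
  shows "card {x. x ^ n + a * x = c} \<le> n"
proof -
  define p where "p = Polynomial.monom 1 n + [:- c, a:]"
  have deg: "degree [:- c, a:] < n"
    using assms by (auto simp: degree_pCons_eq_if)
  then have d: "degree p = n"
    by (simp add: p_def degree_add_eq_left degree_monom_eq)
  then have "p \<noteq> 0" using assms by auto
  then have "card {x. poly p x = 0} \<le> n"
    using card_poly_roots_bound d by blast
  also have "{x. poly p x = 0} = {x. x ^ n + a * x = c}"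
    by (auto simp: p_def poly_monom algebra_simps eq_diff_eq add_eq_0_iff2)
  finally show ?thesis .
qed


section \<open>Conjugation over K in characteristic 2\<close>

context
  fixes s :: nat and cj :: "'a::finite_field \<Rightarrow> 'a"
  assumes s: "s \<ge> 1" and card: "CARD('a) = (2 ^ s) ^ 2"
  defines cj_def: "cj \<equiv> \<lambda>x. x ^ (2 ^ s)"
begin

lemma cj_simps [simp]:
  "cj 0 = 0" "cj 1 = 1" "cj (x + y) = cj x + cj y" "cj (x * y) = cj x * cj y"
  "cj (x / y) = cj x / cj y" "cj (x ^ n) = cj x ^ n" "cj (cj x) = x" "cj x = 0 \<longleftrightarrow> x = 0"
  using add_power_q[OF card] power_q_q[OF card]
  by (simp_all add: cj_def power_0_left power_mult_distrib power_divide mult.commute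
        flip: power_mult)

lemma add_self [simp]: "x + x = (0::'a)" "x + (x + y) = (y::'a)"
  using add_self_eq_0[OF card] by (simp_all flip: add.assoc)

text \<open>Removing subtraction lets \<open>algebra_simps\<close> together with
  \<open>add_self\<close> settle the characteristic-2 identities below.\<close>

lemma minus_eq [simp]: "- x = (x::'a)" "x - y = x + (y::'a)"
  by (metis add_self(1) minus_unique, metis add_self(1) minus_unique add_uminus_conv_diff)

lemma eq_iff_add: "(x::'a) = y \<longleftrightarrow> x + y = 0"
  using add_eq_0_iff_eq[OF card] by metis

lemma cj_norm [simp]: "cj (x * cj x) = x * cj x"
  by (simp add: mult.commute)

lemma two_le_q: "2 \<le> (2::nat) ^ s"
  using s by (metis power_increasing one_le_numeral power_one_right)

text \<open>Both claims come from one count: K has at most q elements, as roots of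
  \<open>x^q + x\<close>, while the trace maps the q^2 elements of L into K with fibres of size at
  most q, so no inequality is strict.\<close>

lemma
  shows card_fixed: "card {x. cj x = x} = 2 ^ s"
    and trace_surj: "cj k = k \<Longrightarrow> \<exists>x. x + cj x = k"
proof -
  have "{x. cj x = x} = {x. x ^ (2 ^ s) + 1 * x = 0}"
    using eq_iff_add by (auto simp: cj_def)
  then have le: "card {x. cj x = x} \<le> 2 ^ s"
    using card_power_plus_linear_le[of "2 ^ s" 1 0] two_le_q by simp
  have img: "range (\<lambda>x. x + cj x) \<subseteq> {x. cj x = x}" by (auto simp: add.commute)
  have fib: "card {x \<in> UNIV. x + cj x = b} \<le> 2 ^ s" for b
    using card_power_plus_linear_le[of "2 ^ s" 1 b] two_le_q by (simp add: cj_def add.commute)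
  have eq: "range (\<lambda>x. x + cj x) = {x. cj x = x}"
    by (rule image_eq_by_fibre_count[OF _ _ img fib])
      (use le in \<open>simp_all add: card power2_eq_square\<close>)
  show "\<exists>x. x + cj x = k" if "cj k = k"
  proof -
    have "k \<in> range (\<lambda>x. x + cj x)" using eq that by simp
    then show ?thesis by (auto simp: image_iff)
  qed
  have "(2 ^ s) ^ 2 \<le> 2 ^ s * card (range (\<lambda>x. x + cj x))"
    using card_le_mult_card_image[of UNIV "\<lambda>x. x + cj x" "2 ^ s"] fib card by simp
  then show "card {x. cj x = x} = 2 ^ s" using le unfolding eq by (simp add: power2_eq_square)
qed

lemma norm_surj:
  assumes "cj k = k" "k \<noteq> 0"
  shows "\<exists>x. x * cj x = k"
proof -
  have cardK: "card {x. cj x = x \<and> x \<noteq> 0} = 2 ^ s - 1"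
  proof -
    have "{x. cj x = x \<and> x \<noteq> 0} = {x. cj x = x} - {0}" by auto
    then show ?thesis using card_fixed by simp
  qed
  have "(\<lambda>x. x * cj x) ` (UNIV - {0}) = {x. cj x = x \<and> x \<noteq> 0}"
  proof (rule image_eq_by_fibre_count)
    fix b :: 'a
    have "{x. x * cj x = b} = {x. x ^ (2 ^ s + 1) + 0 * x = b}" by (simp add: cj_def)
    then have "card {x. x * cj x = b} \<le> 2 ^ s + 1"
      using card_power_plus_linear_le[of "2 ^ s + 1" 0 b] by simp
    moreover have "card {x \<in> UNIV - {0}. x * cj x = b} \<le> card {x. x * cj x = b}"
      by (rule card_mono) auto
    ultimately show "card {x \<in> UNIV - {0}. x * cj x = b} \<le> 2 ^ s + 1" by simp
  qed (use cardK card in \<open>auto simp: card_Diff_subset power2_eq_square algebra_simps\<close>)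
  then have "k \<in> (\<lambda>x. x * cj x) ` (UNIV - {0})" using assms by simp
  then show ?thesis by (auto simp: image_iff)
qed

lemma hilbert90:
  assumes "x * cj x = 1"
  shows "\<exists>u. u \<noteq> 0 \<and> cj u = x * u"
proof -
  have "{x. x * cj x = 1} = {x. x ^ (2 ^ s + 1) + 0 * x = 1}" by (simp add: cj_def)
  then have cardU: "card {x. x * cj x = 1} \<le> 2 ^ s + 1"
    using card_power_plus_linear_le[of "2 ^ s + 1" 0 1] by simp
  have "(\<lambda>u. cj u / u) ` (UNIV - {0}) = {x. x * cj x = 1}"
  proof (rule image_eq_by_fibre_count)
    fix b :: 'a
    \<comment> \<open>Zero solves \<open>cj u = b * u\<close> but lies outside the domain; the bound
      q - 1 gained this way makes the count sharp, as q^2 - 1 = (q - 1)(q + 1).\<close>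
    have "{u \<in> UNIV - {0}. cj u / u = b} = {u. u ^ (2 ^ s) + b * u = 0} - {0}"
      using eq_iff_add by (auto simp: cj_def field_simps)
    also have "card \<dots> = card {u. u ^ (2 ^ s) + b * u = 0} - 1"
      by (subst card_Diff_singleton) auto
    also have "\<dots> \<le> 2 ^ s - 1"
      using card_power_plus_linear_le[of "2 ^ s" b 0] two_le_q by simp
    finally show "card {u \<in> UNIV - {0}. cj u / u = b} \<le> 2 ^ s - 1" .
    show "(2 ^ s - 1) * card {x. x * cj x = 1} \<le> card (UNIV - {0::'a})"
    proof -
      have "(2 ^ s - 1) * card {x. x * cj x = 1} \<le> (2 ^ s - 1) * (2 ^ s + 1)"
        using cardU by (rule mult_le_mono2)
      also have "\<dots> = (2 ^ s) ^ 2 - 1"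
        using two_le_q by (simp add: power2_eq_square algebra_simps)
      finally show ?thesis by (simp add: card_Diff_subset card)
    qed
  qed (use two_le_q in \<open>auto simp: power_0_left\<close>)
  then have "x \<in> (\<lambda>u. cj u / u) ` (UNIV - {0})" using assms by simp
  then show ?thesis by (auto simp: field_simps)
qed

text \<open>On K the q-th power is the identity, so the power q/2 inverts squaring;
  \<open>s >= 1\<close> makes q/2 an integer.\<close>

lemma fixed_sqrt:
  assumes "cj k = k"
  shows "\<exists>r. cj r = r \<and> r ^ 2 = k"
proof (intro exI conjI)
  show "cj (k ^ (2 ^ (s - 1))) = k ^ (2 ^ (s - 1))" using assms by simp
  have "(k ^ (2 ^ (s - 1))) ^ 2 = k ^ (2 ^ (s - 1) * 2)" by (rule power_mult[symmetric])
  also have "(2::nat) ^ (s - 1) * 2 = 2 ^ s" using s by (metis power_minus_mult less_le_trans zero_less_one)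
  finally show "(k ^ (2 ^ (s - 1))) ^ 2 = k" using assms by (simp add: cj_def)
qed

text \<open>\<open>z \<mapsto> z\<^sup>2 + z\<close> maps the \<open>2q\<close> elements whose trace is 0 or 1 two-to-one into
  the \<open>q\<close> elements of the subfield.\<close>

lemma artin_schreier:
  assumes "cj k = k"
  shows "\<exists>z. z ^ 2 + z = k"
proof -
  obtain w where w: "w + cj w = 1" using trace_surj[of 1] by auto
  define K where "K = {x. cj x = x}"
  have cw: "cj w = w + 1" using w by (metis add_self(2))
  define A where "A = K \<union> (\<lambda>x. w + x) ` K"
  have "(\<lambda>z. z ^ 2 + z) ` A = K"
  proof (rule image_eq_by_fibre_count)
    show "(\<lambda>z. z ^ 2 + z) ` A \<subseteq> K"
      by (auto simp: A_def K_def cw power2_eq_square algebra_simps)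
    fix b :: 'a
    have "card {x \<in> A. x ^ 2 + x = b} \<le> card {x. x ^ 2 + 1 * x = b}"
      by (rule card_mono) auto
    also have "\<dots> \<le> 2" by (rule card_power_plus_linear_le) simp
    finally show "card {x \<in> A. x ^ 2 + x = b} \<le> 2" .
    have "K \<inter> (\<lambda>x. w + x) ` K = {}" by (auto simp: K_def cw)
    then have "card A = card K + card ((\<lambda>x. w + x) ` K)"
      unfolding A_def by (intro card_Un_disjoint) auto
    then show "2 * card K \<le> card A" by (simp add: card_image)
  qed auto
  then have "k \<in> (\<lambda>z. z ^ 2 + z) ` A" using assms by (simp add: K_def)
  then show ?thesis by (auto simp: image_iff)
qed


subsection \<open>Sesquilinear forms\<close>

definition sesq :: "'a \<times> 'a \<times> 'a \<times> 'a \<Rightarrow> 'a \<times> 'a \<Rightarrow> 'a \<times> 'a \<Rightarrow> 'a" where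
  "sesq = (\<lambda>(p1, p2, p3, p4) (a, b) (c, d).
     p1 * a * cj c + p2 * b * cj c + p3 * a * cj d + p4 * b * cj d)"

text \<open>Splitting off the form makes a change of basis transparent: one linear map applied to
  both factors transforms the form and multiplies the determinant by a constant.\<close>

lemma B_mult_sesq:
  "B_mult s l t x y = (sesq t x y + l * sesq t y x, fst x * snd y + snd x * fst y)"
  by (cases t; cases x; cases y)
    (simp add: B_mult_def sesq_def Let_def cj_def algebra_simps)

lemma sesq_combination:
  "sesq t (a * e1 + b * e2, a * f1 + b * f2) (c * e1 + d * e2, c * f1 + d * f2) =
     a * cj c * sesq t (e1, f1) (e1, f1) + a * cj d * sesq t (e1, f1) (e2, f2) +
     b * cj c * sesq t (e2, f2) (e1, f1) + b * cj d * sesq t (e2, f2) (e2, f2)"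
  by (cases t) (simp add: sesq_def algebra_simps)

lemma sesq_diag: "sesq (p, 0, 0, r) (a, b) (c, d) = p * a * cj c + r * b * cj d"
  by (simp add: sesq_def)

text \<open>The polynomial is the form at \<open>(x, 1)\<close>; every nonzero vector is a multiple
  of such a one or of \<open>(1, 0)\<close>, and scaling by \<open>d\<close> multiplies the value by
  the nonzero norm \<open>d * cj d\<close>.\<close>

lemma legitimate_iff_anisotropic:
  "legitimate s t \<longleftrightarrow> (\<forall>v. v \<noteq> (0, 0) \<longrightarrow> sesq t v v \<noteq> 0)"
proof -
  obtain p1 p2 p3 p4 where t: "t = (p1, p2, p3, p4)" by (cases t)
  have poly: "sesq t (x, 1) (x, 1) = p1 * x ^ (2 ^ s + 1) + p2 * x ^ (2 ^ s) + p3 * x + p4" for x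
    by (simp add: sesq_def t cj_def algebra_simps)
  have lead: "sesq t (x, 0) (x, 0) = p1 * x * cj x" for x by (simp add: sesq_def t)
  show ?thesis
  proof
    assume L: "legitimate s t"
    show "\<forall>v. v \<noteq> (0, 0) \<longrightarrow> sesq t v v \<noteq> 0"
    proof (intro allI impI)
      fix v :: "'a \<times> 'a" assume v: "v \<noteq> (0, 0)"
      obtain c d where cd: "v = (c, d)" by (cases v)
      show "sesq t v v \<noteq> 0"
      proof (cases "d = 0")
        case True
        then show ?thesis using L v lead[of c] by (simp add: cd legitimate_def t)
      next
        case False
        have "sesq t v v = d * cj d * sesq t (c / d, 1) (c / d, 1)"
          using False by (simp add: cd sesq_def t field_simps)
        moreover have "sesq t (c / d, 1) (c / d, 1) \<noteq> 0"
          using L unfolding poly unfolding legitimate_def t split_conv by blast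
        ultimately show ?thesis using False by simp
      qed
    qed
  next
    assume A: "\<forall>v. v \<noteq> (0, 0) \<longrightarrow> sesq t v v \<noteq> 0"
    then have "sesq t (1, 0) (1, 0) \<noteq> 0" "sesq t (x, 1) (x, 1) \<noteq> 0" for x by auto
    then show "legitimate s t" using lead[of 1] by (simp only: poly) (simp add: legitimate_def t)
  qed
qed

section \<open>Diagonalising an anisotropic form\<close>

lemma diagonal_isotopic:
  assumes leg: "legitimate s (t :: 'a \<times> 'a \<times> 'a \<times> 'a)" and l: "l \<notin> powers_q_minus_1 s" "l \<noteq> 0"
    and det: "e1 * f2 + f1 * e2 \<noteq> 0"
    and orth: "sesq t (e1, f1) (e2, f2) = 0" "sesq t (e2, f2) (e1, f1) = 0"
  defines "t' \<equiv> (sesq t (e1, f1) (e1, f1), 0, 0, sesq t (e2, f2) (e2, f2))"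
  shows "legitimate s t' \<and> isotopic (B_mult s l t) (B_mult s l t')"
proof
  define A where "A = (\<lambda>(a, b). (a * e1 + b * e2, a * f1 + b * f2))"
  have t': "sesq t (A x) (A y) = sesq t' x y" for x y
    by (cases x; cases y) (simp add: A_def sesq_combination orth sesq_diag t'_def mult_ac)
  have A0: "x = (0, 0)" if "A x = (0, 0)" for x
  proof -
    obtain a b where x: "x = (a, b)" by (cases x)
    have 0: "a * e1 + b * e2 = 0" "a * f1 + b * f2 = 0" using that by (simp_all add: A_def x)
    \<comment> \<open>Cramer's rule, so that a nonzero determinant makes \<open>A\<close>
      injective.\<close>
    have "a * (e1 * f2 + f1 * e2) = (a * e1 + b * e2) * f2 + (a * f1 + b * f2) * e2"
      "b * (e1 * f2 + f1 * e2) = (a * e1 + b * e2) * f1 + (a * f1 + b * f2) * e1"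
      by (simp_all add: algebra_simps)
    then show ?thesis unfolding 0 using det x by simp
  qed
  show leg': "legitimate s t'"
    using leg A0 unfolding legitimate_iff_anisotropic t'[symmetric] by blast
  show "isotopic (B_mult s l t) (B_mult s l t')"
  proof (rule isotopicI[OF presemifield_B_mult[OF card leg l] presemifield_B_mult[OF card leg' l]])
    show "additive A" "additive A"
      by (simp_all add: additive_def A_def split_beta algebra_simps)
    \<comment> \<open>This map divides out the factor by which \<open>A\<close> multiplies
      determinants.\<close>
    show "additive (\<lambda>(x, y). (x, y / (e1 * f2 + f1 * e2)))"
      by (simp add: additive_def split_beta add_divide_distrib)
    show "(\<lambda>(x, y). (x, y / (e1 * f2 + f1 * e2))) (B_mult s l t (A x) (A y)) = B_mult s l t' x y"
      for x y
    proof -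
      have "fst (A x) * snd (A y) + snd (A x) * fst (A y) =
          (fst x * snd y + snd x * fst y) * (e1 * f2 + f1 * e2)"
        by (simp add: A_def split_beta algebra_simps)
      then show ?thesis using det by (simp add: B_mult_sesq t')
    qed
  qed
qed

text \<open>The equations say that \<open>(z1, 1)\<close> and \<open>(z2, 1)\<close> are orthogonal,
  in both orders, for a normalised form. With \<open>k = z2 * cj z1\<close> they read
  \<open>z2 = h + k\<close> and \<open>z1 = h + cj k\<close>; hence
  \<open>k = (h + k) * (cj h + k)\<close>, the quadratic over K that is solved here.\<close>

lemma orthogonal_pair:
  assumes "\<And>z. z * cj z + z + h \<noteq> 0"
  shows "\<exists>z1 z2. z1 \<noteq> z2 \<and> z1 * cj z2 + z1 + h = 0 \<and> z2 * cj z1 + z2 + h = 0"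
proof -
  define c where "c = h + cj h + 1"
  have noroot: "k ^ 2 + c * k + h * cj h \<noteq> 0" if "cj k = k" for k
  proof
    assume "k ^ 2 + c * k + h * cj h = 0"
    then have "(h + k) * cj (h + k) + (h + k) + h = 0"
      by (simp add: c_def that power2_eq_square algebra_simps)
    then show False using assms by blast
  qed
  have cc: "cj c = c" by (simp add: c_def add_ac)
  \<comment> \<open>For \<open>c = 0\<close> the quadratic would be \<open>X^2 + h * cj h\<close>, a
    square with its root in K.\<close>
  have c0: "c \<noteq> 0"
  proof
    assume "c = 0"
    obtain k where "cj k = k" "k ^ 2 = h * cj h" using fixed_sqrt[of "h * cj h"] by auto
    then show False using noroot[of k] \<open>c = 0\<close> by simp
  qed
  obtain y where y: "y ^ 2 + y = h * cj h / c ^ 2"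
    using artin_schreier[of "h * cj h / c ^ 2"] cc by (auto simp: mult.commute)
  define k where "k = c * y"
  have "k ^ 2 + c * k = c ^ 2 * (y ^ 2 + y)"
    by (simp add: k_def power2_eq_square algebra_simps)
  then have root: "k ^ 2 + c * k + h * cj h = 0" using y c0 by simp
  have "cj (k ^ 2 + c * k + h * cj h) = 0" using root by simp
  then have root': "cj k ^ 2 + c * cj k + h * cj h = 0" by (simp add: cc mult.commute)
  have "(h + cj k) * cj (h + k) + (h + cj k) + h = cj k ^ 2 + c * cj k + h * cj h"
    "(h + k) * cj (h + cj k) + (h + k) + h = k ^ 2 + c * k + h * cj h"
    by (simp_all add: c_def power2_eq_square algebra_simps)
  \<comment> \<open>Equality of the two witnesses would mean \<open>cj k = k\<close>, a root in
    K.\<close>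
  then show ?thesis
    using root root' noroot[of k] by (intro exI[of _ "h + cj k"] exI[of _ "h + k"]) auto
qed

lemma orthogonal_basis:
  assumes "legitimate s t"
  shows "\<exists>e1 f1 e2 f2. e1 * f2 + f1 * e2 \<noteq> 0 \<and>
    sesq t (e1, f1) (e2, f2) = 0 \<and> sesq t (e2, f2) (e1, f1) = 0"
proof -
  obtain p1 p2 p3 p4 where t0: "t = (p1, p2, p3, p4)" by (cases t)
  have aniso: "sesq t v v \<noteq> 0" if "v \<noteq> (0, 0)" for v
    using assms that legitimate_iff_anisotropic by blast
  have p1: "p1 \<noteq> 0" using assms by (simp add: t0 legitimate_def)
  \<comment> \<open>Shifting the first coordinate by \<open>k\<close> removes the \<open>p2\<close>
    term, and \<open>g\<close> is what is then left of the \<open>p3\<close> coefficient, up to the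
    factor \<open>p1\<close>.\<close>
  define k where "k = p2 / p1"
  define g where "g = p3 / p1 + cj k"
  have p2: "p2 = p1 * k" and p3: "p3 = p1 * (g + cj k)"
    using p1 by (simp_all add: k_def g_def add_ac)
  show ?thesis
  proof (cases "g = 0")
    case True
    then have "sesq t (1, 0) (k, 1) = 0" "sesq t (k, 1) (1, 0) = 0"
      by (simp_all add: t0 p2 p3 sesq_def)
    then show ?thesis by (intro exI[of _ 1] exI[of _ 0] exI[of _ k]) simp
  next
    case False
    define h where "h = (p4 / p1 + k * (g + cj k)) / (g * cj g)"
    have p4: "p4 = p1 * (g * cj g * h + k * (g + cj k))"
      using p1 False by (simp add: h_def add_ac)
    \<comment> \<open>Scaling by \<open>cj g\<close> equalises the two remaining coefficients,
      giving \<open>x * cj y + x + h\<close> up to a constant factor.\<close>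
    have S: "sesq t (cj g * x + k, 1) (cj g * y + k, 1) = p1 * (g * cj g) * (x * cj y + x + h)"
      for x y
      by (simp add: t0 p2 p3 p4 sesq_def algebra_simps)
    have "z * cj z + z + h \<noteq> 0" for z
      using aniso[of "(cj g * z + k, 1)"] S[of z z] by auto
    then obtain z1 z2 where z: "z1 \<noteq> z2" "z1 * cj z2 + z1 + h = 0" "z2 * cj z1 + z2 + h = 0"
      using orthogonal_pair by blast
    have "(cj g * z1 + k) * 1 + 1 * (cj g * z2 + k) = cj g * (z1 + z2)"
      by (simp add: algebra_simps)
    also have "\<dots> \<noteq> 0" using False z(1) eq_iff_add by auto
    finally show ?thesis using S z(2,3) by (metis mult_zero_right)
  qed
qed

section \<open>Passing between diagonal forms and B_q(w)\<close>

lemma powers_q_minus_1_iff_norm: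
  assumes "l \<noteq> 0"
  shows "l \<in> powers_q_minus_1 s \<longleftrightarrow> l * cj l = 1"
proof -
  have q1: "u * u ^ (2 ^ s - 1) = cj u" for u
    by (metis cj_def power_eq_if power_not_zero zero_neq_numeral)
  have iff: "l = u ^ (2 ^ s - 1) \<longleftrightarrow> cj u = l * u" if "u \<noteq> 0" for u
    using that q1[of u] by (metis mult.commute mult_cancel_left)
  show ?thesis
  proof
    assume "l \<in> powers_q_minus_1 s"
    then obtain u where u: "u \<noteq> 0" "cj u = l * u" using iff by (auto simp: powers_q_minus_1_def)
    then have "u = cj (l * u)" by (metis cj_simps(7))
    also have "\<dots> = l * cj l * u" using u by simp
    finally show "l * cj l = 1" using u(1) by (metis mult_cancel_right1)
  next
    assume "l * cj l = 1"
    then obtain u where "u \<noteq> 0" "cj u = l * u" using hilbert90 by blast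
    then show "l \<in> powers_q_minus_1 s" using iff by (auto simp: powers_q_minus_1_def)
  qed
qed

text \<open>The maps come from comparing coefficients: conjugation in \<open>\<alpha>1\<close>
  produces the \<open>a^q\<close> in the second component of B_q(w), \<open>\<beta>\<close> cancels
  the \<open>cj x1 * cj x2\<close> terms, and \<open>u\<close>, \<open>t\<close> make the
  coefficients of \<open>x1 * x2\<close> and \<open>y1 * cj y2\<close> agree. The remaining
  coefficient, divided by this common value, is \<open>w\<close>.\<close>

lemma diagonal_isotopic_Bq:
  assumes leg: "legitimate s (a, 0, 0, d)" and l: "l \<notin> powers_q_minus_1 s" "l \<noteq> 0"
    and n: "cj n = n" "l * cj l = n ^ 2"
  defines "r \<equiv> cj a * d"
  defines "w \<equiv> (n ^ 2 * r + cj r) / (n * (r + cj r))"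
  shows "w \<notin> subK s \<and> abs_trace s (1 / rel_trace s w) = 0 \<and>
    isotopic (B_mult s l (a, 0, 0, d)) (Bq_mult s w)"
proof -
  have a: "a \<noteq> 0" using leg by (simp add: legitimate_def)
  have n0: "n \<noteq> 0" using n(2) l(2) by auto
  \<comment> \<open>Here the hypothesis on \<open>l\<close> enters: its norm \<open>n^2\<close>
    differs from 1.\<close>
  have n1: "n + 1 \<noteq> 0"
    using n(2) l powers_q_minus_1_iff_norm[of l] eq_iff_add[of n 1] by auto
  have n21: "n ^ 2 + 1 = (n + 1) ^ 2" by (simp add: power2_eq_square algebra_simps)
  \<comment> \<open>Otherwise \<open>d / a\<close> is in K, hence a norm \<open>x * cj x\<close>,
    and \<open>(x, 1)\<close> is isotropic.\<close>
  have \<theta>: "r + cj r \<noteq> 0"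
  proof
    assume "r + cj r = 0"
    then have "cj (d / a) = d / a"
      using a eq_iff_add[of r "cj r"] by (simp add: r_def field_simps)
    moreover have "d / a \<noteq> 0"
    proof -
      have "sesq (a, 0, 0, d) (0, 1) (0, 1) \<noteq> 0"
        using leg by (simp add: legitimate_iff_anisotropic)
      then show ?thesis using a by (simp add: sesq_def)
    qed
    ultimately obtain x where "x * cj x = d / a" using norm_surj by blast
    then have "sesq (a, 0, 0, d) (x, 1) (x, 1) = 0"
      using a by (simp add: sesq_def mult.assoc)
    then show False using leg unfolding legitimate_iff_anisotropic by fastforce
  qed
  have cjw: "cj w = (n ^ 2 * cj r + r) / (n * (r + cj r))"
    by (simp add: w_def n add.commute)
  have tr: "rel_trace s w = (n ^ 2 + 1) / n"
  proof -
    have "rel_trace s w = w + cj w" by (simp add: rel_trace_def cj_def)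
    also have "\<dots> = ((n ^ 2 + 1) * (r + cj r)) / (n * (r + cj r))"
      unfolding cjw unfolding w_def by (simp add: algebra_simps flip: add_divide_distrib)
    finally show ?thesis using \<theta> by simp
  qed
  have wK: "w \<notin> subK s"
  proof
    assume "w \<in> subK s"
    then have "rel_trace s w = 0" by (simp add: rel_trace_def subK_def)
    then show False using tr n0 n1 by (simp add: n21)
  qed
  \<comment> \<open>\<open>1 / (n + 1)\<close> lies in K, so the telescoped sum
    \<open>y^q + y\<close> vanishes for it.\<close>
  have w0: "abs_trace s (1 / rel_trace s w) = 0"
  proof -
    have "(1 / m) ^ 2 + 1 / m = (1 + m) / m ^ 2" if "m \<noteq> 0" for m :: 'a
      using that by (simp add: add_divide_distrib power2_eq_square)
    from this[OF n1] have "(1 / (n + 1)) ^ 2 + 1 / (n + 1) = (1 + (n + 1)) / (n + 1) ^ 2" .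
    also have "1 + (n + 1) = n" using add_self(2)[of 1 n] by (simp only: add.commute)
    also have "n / (n + 1) ^ 2 = 1 / rel_trace s w" unfolding tr n21 by simp
    finally have "abs_trace s (1 / rel_trace s w) = cj (1 / (n + 1)) + 1 / (n + 1)"
      using abs_trace_telescope[OF card, of s "1 / (n + 1)"] by (simp add: cj_def)
    then show ?thesis by (simp add: n)
  qed
  \<comment> \<open>\<open>A * t\<close> will be the common coefficient of \<open>x1 * x2\<close>
    and \<open>y1 * cj y2\<close>.\<close>
  define A where "A = a * cj a * (n ^ 2 + 1)"
  have A0: "A \<noteq> 0" using a n1 by (simp add: A_def n21)
  have cA: "cj (A / (n * (r + cj r))) = A / (n * (r + cj r))"
    by (simp add: A_def n add.commute mult.commute)
  obtain u where u: "u * cj u = A / (n * (r + cj r))"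
    using norm_surj[OF cA] A0 n0 \<theta> by auto
  have u0: "u \<noteq> 0" using u A0 n0 \<theta> by auto
  \<comment> \<open>Hilbert 90 supplies \<open>t\<close> with \<open>cj l * cj t = n * t\<close>,
    which turns the \<open>cj t\<close> in the coefficient of \<open>y1 * cj y2\<close> into
    \<open>t\<close>.\<close>
  have "l / n * cj (l / n) = 1" using n n0 by (simp add: power2_eq_square)
  then obtain t where t: "t \<noteq> 0" "cj t = l / n * t" using hilbert90 by blast
  have "l * t = n * cj t" using t(2) n0 by simp
  then have "cj (l * t) = cj (n * cj t)" by (rule arg_cong)
  then have "cj l * cj t = n * t" by (simp add: n)
  define \<alpha>1 where "\<alpha>1 = (\<lambda>(x, y). (cj x, u * y))"
  define \<alpha>2 where "\<alpha>2 = (\<lambda>(x, y). (t * x, u * t * y))"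
  define \<beta> where "\<beta> = (\<lambda>(x, y). ((cj l * cj a * x + a * cj x) / (A * t), y / (u * t)))"
  have "isotopic (B_mult s l (a, 0, 0, d)) (Bq_mult s w)"
  proof (rule isotopicI)
    show "presemifield (B_mult s l (a, 0, 0, d))"
      by (rule presemifield_B_mult[OF card leg l])
    show "presemifield (Bq_mult s w)"
      using semifield_Bq_mult[OF card wK w0] by (simp add: semifield_def)
    show "additive \<alpha>1" "additive \<alpha>2" "additive \<beta>"
      by (simp_all add: additive_def \<alpha>1_def \<alpha>2_def \<beta>_def split_beta algebra_simps
            flip: add_divide_distrib)
    show "\<beta> (B_mult s l (a, 0, 0, d) (\<alpha>1 x) (\<alpha>2 y)) = Bq_mult s w x y" for x y
    proof -
      obtain x1 y1 x2 y2 where xy: "x = (x1, y1)" "y = (x2, y2)" by (cases x; cases y)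
      define Z where "Z = a * (cj x1 * cj (t * x2) + l * x1 * (t * x2))
        + d * (u * y1 * cj (u * t * y2) + l * cj (u * y1) * (u * t * y2))"
      have B: "B_mult s l (a, 0, 0, d) (\<alpha>1 x) (\<alpha>2 y) = (Z, u * t * (cj x1 * y2 + y1 * x2))"
        by (simp add: B_mult_sesq sesq_def xy \<alpha>1_def \<alpha>2_def Z_def algebra_simps)
      have "cj l * cj a * Z + a * cj Z = a * cj a * (l * cj l + 1) * t * (x1 * x2)
          + cj l * cj t * (u * cj u) * (r + cj r) * (y1 * cj y2)
          + u * cj u * t * (l * cj l * r + cj r) * (cj y1 * y2)"
        by (simp add: Z_def r_def algebra_simps)
      also have "a * cj a * (l * cj l + 1) = A" by (simp add: A_def n)
      also have "cj l * cj t * (u * cj u) * (r + cj r) = A * t"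
        using n0 \<theta> by (simp add: \<open>cj l * cj t = n * t\<close> u)
      also have "u * cj u * t * (l * cj l * r + cj r) = A * t * w"
        by (simp add: n u w_def)
      finally have "cj l * cj a * Z + a * cj Z = A * t * (x1 * x2 + y1 * cj y2 + w * cj y1 * y2)"
        by (simp add: algebra_simps)
      then show ?thesis
        unfolding B using A0 t(1) u0 by (simp add: \<beta>_def Bq_mult_def xy Let_def cj_def)
    qed
  qed
  then show ?thesis using wK w0 by blast
qed

lemma B_isotopic_Bq:
  assumes leg: "legitimate s (t :: 'a \<times> 'a \<times> 'a \<times> 'a)" and l: "l \<notin> powers_q_minus_1 s" "l \<noteq> 0"
  shows "\<exists>w. w \<notin> subK s \<and> abs_trace s (1 / rel_trace s w) = 0 \<and>
    isotopic (B_mult s l t) (Bq_mult s w)"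
proof -
  obtain e1 f1 e2 f2 where "e1 * f2 + f1 * e2 \<noteq> 0"
    "sesq t (e1, f1) (e2, f2) = 0" "sesq t (e2, f2) (e1, f1) = 0"
    using orthogonal_basis[OF leg] by blast
  from diagonal_isotopic[OF leg l this] obtain a d
    where ad: "legitimate s (a, 0, 0, d)" "isotopic (B_mult s l t) (B_mult s l (a, 0, 0, d))"
    by blast
  obtain n where "cj n = n" "l * cj l = n ^ 2"
    using fixed_sqrt[of "l * cj l"] by auto
  then show ?thesis
    using diagonal_isotopic_Bq[OF ad(1) l] isotopic_trans[OF ad(2)] by blast
qed

lemma Bq_isotopic_B:
  fixes w :: 'a
  assumes w: "w \<notin> subK s" "abs_trace s (1 / rel_trace s w) = 0"
  shows "\<exists>(l::'a) t. legitimate s t \<and> l \<noteq> 0 \<and> l \<notin> powers_q_minus_1 s \<and>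
    isotopic (Bq_mult s w) (B_mult s l t)"
proof -
  define T where "T = rel_trace s w"
  have T: "T = w + cj w" by (simp add: T_def rel_trace_def cj_def)
  have T0: "T \<noteq> 0" using w(1) eq_iff_add[of w "cj w"] by (auto simp: T subK_def cj_def)
  have cT: "cj (1 / T) = 1 / T" by (simp add: T add.commute)
  then obtain z where z: "z ^ 2 + z = 1 / T" using artin_schreier by blast
  \<comment> \<open>The absolute trace of \<open>z^2 + z\<close> telescopes to
    \<open>cj z + z\<close>, so its vanishing puts \<open>z\<close> in K.\<close>
  have "cj z + z = 0"
    using w(2) abs_trace_telescope[OF card, of s z] by (simp add: z cj_def T_def)
  then have cz: "cj z = z" using eq_iff_add by metis
  have z0: "z \<noteq> 0" and z1: "z + 1 \<noteq> 0"
    using z T0 eq_iff_add[of z 1] by auto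
  \<comment> \<open>Solves \<open>z = 1 / (n + 1)\<close>, so that \<open>n + 1 / n\<close> equals
    the trace \<open>T\<close>.\<close>
  define n where "n = (z + 1) / z"
  have cn: "cj n = n" by (simp add: n_def cz)
  have n0: "n \<noteq> 0" using z0 z1 by (simp add: n_def)
  have n1: "n + 1 = 1 / z" using z0 by (simp add: n_def field_simps)
  have n21: "n ^ 2 + 1 = (n + 1) ^ 2" by (simp add: power2_eq_square algebra_simps)
  have "n * T = n ^ 2 + 1"
  proof -
    have "z * (z + 1) = 1 / T" by (simp add: z[symmetric] power2_eq_square algebra_simps)
    then have "T = 1 / (z * (z + 1))" by simp
    then show ?thesis using z0 z1 by (simp add: n21 n1) (simp add: n_def power2_eq_square)
  qed
  \<comment> \<open>Imposing \<open>r + cj r = 1\<close> on the formula for \<open>w\<close> leaves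
    \<open>n * w = (n^2 + 1) * r + 1\<close>, solved for \<open>r\<close>.\<close>
  define r where "r = (n * w + 1) / (n ^ 2 + 1)"
  have n20: "n ^ 2 + 1 \<noteq> 0" using z0 by (simp add: n21 n1)
  have "r + cj r = n * T / (n ^ 2 + 1)"
    by (simp add: r_def T cn algebra_simps flip: add_divide_distrib)
  then have r1: "r + cj r = 1" using \<open>n * T = n ^ 2 + 1\<close> n20 by simp
  then have cr: "cj r = r + 1" by (metis add_self(2))
  have "n ^ 2 * r + cj r = (n ^ 2 + 1) * r + 1" by (simp add: cr algebra_simps)
  also have "(n ^ 2 + 1) * r = n * w + 1" using n20 by (simp add: r_def)
  finally have "n ^ 2 * r + cj r = n * w" by (simp add: add_ac)
  then have weq: "w = (n ^ 2 * r + cj r) / (n * (r + cj r))"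
    using n0 unfolding r1 by simp
  have leg: "legitimate s (1, 0, 0, r)"
  proof -
    \<comment> \<open>A root would make \<open>r\<close> a norm, hence an element of K, against
      \<open>cj r = r + 1\<close>.\<close>
    have "x * cj x + r \<noteq> 0" for x
      using eq_iff_add[of "x * cj x" r] cj_norm[of x] cr by auto
    then show ?thesis by (simp add: legitimate_def cj_def)
  qed
  have l: "n \<notin> powers_q_minus_1 s"
    using powers_q_minus_1_iff_norm[OF n0] n20 eq_iff_add[of "n ^ 2" 1]
    by (simp add: cn power2_eq_square)
  have "n * cj n = n ^ 2" by (simp add: cn power2_eq_square)
  from diagonal_isotopic_Bq[OF leg l n0 cn this]
  have "isotopic (B_mult s n (1, 0, 0, r)) (Bq_mult s w)" by (simp add: weq)
  then show ?thesis using leg l n0 isotopic_sym by blast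
qed

end

theorem corollary4:
  fixes s :: nat
  assumes "s \<ge> 1"
    and "CARD('a::finite_field) = (2 ^ s) ^ 2"
  shows
    "(\<forall>(l::'a) t. legitimate s t \<and> l \<noteq> 0 \<and> l \<notin> powers_q_minus_1 s \<longrightarrow>
        (\<exists>w. w \<notin> subK s \<and> abs_trace s (1 / rel_trace s w) = 0 \<and>
             isotopic (B_mult s l t) (Bq_mult s w))) \<and>
     (\<forall>w::'a. w \<notin> subK s \<and> abs_trace s (1 / rel_trace s w) = 0 \<longrightarrow>
        (\<exists>l t. legitimate s t \<and> l \<noteq> 0 \<and> l \<notin> powers_q_minus_1 s \<and>
             isotopic (Bq_mult s w) (B_mult s l t)))"
  using B_isotopic_Bq[OF assms] Bq_isotopic_B[OF assms] by blast

end
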